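(* Let $N\in\mathbb N_0$, $0<p_1,p_2<1$, $p_1\ne p_2$, and let $(n_1,n_2)\in\mathbb N_0^2$. Let $K^{(1)}_{(n_1,n_2)},K^{(2)}_{(n_1,n_2)}$ be the Kravchuk multiple orthogonal polynomials of type I (for the weights $\omega_a(k)=\frac{N!\,p_a^k(1-p_a)^{N-k}}{\Gamma(k+1)\Gamma(N-k+1)}$, $k\in\{0,\dots,N\}$, $a\in\{1,2\}$) biorthogonal to the Kravchuk multiple orthogonal polynomials of type II given in the context. Then, for $a\in\{1,2\}$, $$K^{(a)}_{(n_1,n_2)}(x)=\kappa_a\;F^{2:1;0}_{1:1;0}\left[{(-n_a+1,-N):(-x);--\atop(-n_1-n_2+2):(-N);--}\Bigg|\frac{p_a-\hat p_a}{p_a(1-p_a)},\frac{\hat p_a-p_a}{1-p_a}\right]$$ $$=\kappa_a\sum_{l=0}^{n_a-1}\sum_{m=0}^{n_a-1-l}\frac{(-n_a+1)_{l+m}\,(-N)_{l+m}}{l!\,m!\,(-n_1-n_2+2)_{l+m}\,(-N)_l}\left(\frac{p_a-\hat p_a}{p_a(1-p_a)}\right)^l\left(\frac{\hat p_a-p_a}{1-p_a}\right)^m(-x)_l,$$ where $$\kappa_a=\frac{(-1)^{n_a-1}(n_1+n_2-2)!}{(n_1-1)!\,(n_2-1)!\,(N-n_1-n_2+2)_{n_1+n_2-1}\,(p_a-\hat p_a)^{n_1+n_2-1}}.$$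
   Context: Pochhammer symbol: $(x)_n=\Gamma(x+n)/\Gamma(x)$, i.e. $(x)_0=1$, $(x)_n=x(x+1)\cdots(x+n-1)$. Notation: $\hat p_1=p_2$, $\hat p_2=p_1$. The type II Kravchuk polynomials (monic) are $$K_{(m_1,m_2)}(x)=p_1^{m_1}p_2^{m_2}(-N)_{m_1+m_2}\sum_{l=0}^{m_1+m_2}\sum_{r=0}^l\frac{(-m_1)_r(-m_2)_{l-r}}{r!(l-r)!}\frac{1}{p_1^r}\frac{1}{p_2^{l-r}}\frac{(-x)_l}{(-N)_l}.$$ The type I polynomials biorthogonal to them have $\deg K^{(a)}_{(n_1,n_2)}\le n_a-1$ and satisfy $$\sum_{k=0}^N(-N+k)_j\big(K^{(1)}_{(n_1,n_2)}(k)\omega_1(k)+K^{(2)}_{(n_1,n_2)}(k)\omega_2(k)\big)=0,\quad j\in\{0,\dots,n_1+n_2-2\},$$ and $$\sum_{k=0}^NK_{(m_1,m_2)}(k)\big(K^{(1)}_{(n_1,n_2)}(k)\omega_1(k)+K^{(2)}_{(n_1,n_2)}(k)\omega_2(k)\big)=\begin{cases}0,&n_1\le m_1,\ n_2\le m_2,\\1,&m_1+m_2=n_1+n_2-1,\\0,&m_1+m_2\le n_1+n_2-2.\end{cases}$$ Kampé de Fériet series: $$F^{p:r;s}_{q:n;t}\left[{(a_i):(b_i);(d_i)\atop(\alpha_i):(\beta_i);(\gamma_i)}\Bigg|x,y\right]=\sum_{l,m\ge0}\frac{\prod_i(a_i)_{l+m}}{\prod_i(\alpha_i)_{l+m}}\frac{\prod_i(b_i)_l}{\prod_i(\beta_i)_l}\frac{\prod_i(d_i)_m}{\prod_i(\gamma_i)_m}\frac{x^l}{l!}\frac{y^m}{m!},$$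 "$--$" denoting an empty list.
   Formalization: It is assumed that n_1+n_2 ≤ N+1 (otherwise κ_a divides by zero and the type I polynomials do not exist); when n_1=0 or n_2=0, where the printed formula contains (-1)! or zero denominators, it is read as a limit of its Gamma-function form. *)

theory Defs
  imports "HOL-Analysis.Analysis"
begin

text \<open>
  Quantities carrying an index \<open>a \<in> {1, 2}\<close> (the parameters \<open>p\<^sub>a\<close>, the multi-index \<open>n\<^sub>a\<close>, the
  polynomials of type I) are functions on \<^typ>\<open>nat\<close> of which only the values at 1 and 2 matter.
\<close>

definition hat :: "(nat \<Rightarrow> 'a) \<Rightarrow> nat \<Rightarrow> 'a" where
  "hat p a = (if a = 1 then p 2 else p 1)"

definition poch_list :: "real list \<Rightarrow> nat \<Rightarrow> real" where
  "poch_list cs k = (\<Prod>c\<leftarrow>cs. pochhammer c k)"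

text \<open>
  Since \<open>0 / 0 = 0\<close>, a series with nonpositive integer parameters below the bar
  is cut off where a Pochhammer symbol above the bar becomes zero, as is usual for terminating
  hypergeometric series.
\<close>

definition kampe_de_feriet ::
  "real list \<Rightarrow> real list \<Rightarrow> real list \<Rightarrow> real list \<Rightarrow> real list \<Rightarrow> real list \<Rightarrow> real \<Rightarrow> real \<Rightarrow> real" where
  "kampe_de_feriet as bs ds \<alpha>s \<beta>s \<gamma>s x y =
     (\<Sum>\<^sub>\<infinity>(l, m) \<in> UNIV.
        poch_list as (l + m) / poch_list \<alpha>s (l + m)
        * (poch_list bs l / poch_list \<beta>s l)
        * (poch_list ds m / poch_list \<gamma>s m)
        * (x ^ l / fact l) * (y ^ m / fact m))"

definition kravchuk_weight :: "nat \<Rightarrow> real \<Rightarrow> nat \<Rightarrow> real" where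
  "kravchuk_weight N p k =
     fact N * p ^ k * (1 - p) ^ (N - k) / (Gamma (real k + 1) * Gamma (real N - real k + 1))"

text \<open>Meaningful for \<open>m\<^sub>1 + m\<^sub>2 \<le> N\<close>, where no denominator \<open>(-N)\<^sub>l\<close> is zero.\<close>

definition kravchuk_II :: "nat \<Rightarrow> (nat \<Rightarrow> real) \<Rightarrow> nat \<Rightarrow> nat \<Rightarrow> real \<Rightarrow> real" where
  "kravchuk_II N p m1 m2 x =
     p 1 ^ m1 * p 2 ^ m2 * pochhammer (- real N) (m1 + m2) *
     (\<Sum>l = 0..m1 + m2. \<Sum>r = 0..l.
        pochhammer (- real m1) r * pochhammer (- real m2) (l - r) / (fact r * fact (l - r))
        * (1 / p 1 ^ r) * (1 / p 2 ^ (l - r))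
        * (pochhammer (- x) l / pochhammer (- real N) l))"

definition type_I_form :: "nat \<Rightarrow> (nat \<Rightarrow> real) \<Rightarrow> (nat \<Rightarrow> real poly) \<Rightarrow> nat \<Rightarrow> real" where
  "type_I_form N p K k =
     poly (K 1) (real k) * kravchuk_weight N (p 1) k + poly (K 2) (real k) * kravchuk_weight N (p 2) k"

text \<open>
  The bound \<open>deg K\<^sub>a \<le> n\<^sub>a - 1\<close> forces \<open>K\<^sub>a = 0\<close> when \<open>n\<^sub>a = 0\<close>. Index conditions such as
  \<open>j \<le> n\<^sub>1 + n\<^sub>2 - 2\<close> are written without the truncating subtraction.
\<close>

definition kravchuk_type_I ::
  "nat \<Rightarrow> (nat \<Rightarrow> real) \<Rightarrow> (nat \<Rightarrow> nat) \<Rightarrow> (nat \<Rightarrow> real poly) \<Rightarrow> bool" where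
  "kravchuk_type_I N p n K \<longleftrightarrow>
     (\<forall>a\<in>{1, 2}. K a = 0 \<or> degree (K a) + 1 \<le> n a) \<and>
     (\<forall>j. j + 2 \<le> n 1 + n 2 \<longrightarrow>
        (\<Sum>k = 0..N. pochhammer (- real N + real k) j * type_I_form N p K k) = 0) \<and>
     (\<forall>m1 m2. m1 + m2 \<le> N \<longrightarrow>
        (n 1 \<le> m1 \<and> n 2 \<le> m2 \<longrightarrow>
           (\<Sum>k = 0..N. kravchuk_II N p m1 m2 (real k) * type_I_form N p K k) = 0) \<and>
        (m1 + m2 + 1 = n 1 + n 2 \<longrightarrow>
           (\<Sum>k = 0..N. kravchuk_II N p m1 m2 (real k) * type_I_form N p K k) = 1) \<and>
        (m1 + m2 + 2 \<le> n 1 + n 2 \<longrightarrow>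
           (\<Sum>k = 0..N. kravchuk_II N p m1 m2 (real k) * type_I_form N p K k) = 0))"

definition kravchuk_kappa :: "nat \<Rightarrow> (nat \<Rightarrow> real) \<Rightarrow> (nat \<Rightarrow> nat) \<Rightarrow> nat \<Rightarrow> real" where
  "kravchuk_kappa N p n a =
     (-1) ^ (n a - 1) * fact (n 1 + n 2 - 2) /
     (fact (n 1 - 1) * fact (n 2 - 1)
      * pochhammer (real N - real (n 1) - real (n 2) + 2) (n 1 + n 2 - 1)
      * (p a - hat p a) ^ (n 1 + n 2 - 1))"

text \<open>
  If \<open>n\<^sub>1 = 0\<close> or \<open>n\<^sub>2 = 0\<close>, then \<open>\<kappa>\<^sub>a\<close> contains the factorial of a negative integer, and a
  Pochhammer symbol \<open>(-n\<^sub>1-n\<^sub>2+2)\<^sub>l\<^sub>+\<^sub>m\<close> below the bar can be zero. The product of \<open>\<kappa>\<^sub>a\<close> with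
  the series is then read as its limit for \<open>\<epsilon> \<rightarrow> 0\<close>, where \<open>n\<^sub>b\<close>, \<open>b \<noteq> a\<close>, is replaced by
  \<open>n\<^sub>b + \<epsilon>\<close> in the singular terms: \<open>(n\<^sub>1+n\<^sub>2-2)! / (n\<^sub>b-1)!\<close> becomes
  \<open>\<Gamma>(n\<^sub>1+n\<^sub>2-1+\<epsilon>) / \<Gamma>(n\<^sub>b+\<epsilon>)\<close>, and \<open>-n\<^sub>1-n\<^sub>2+2\<close> becomes \<open>-n\<^sub>1-n\<^sub>2+2-\<epsilon>\<close>.
  The factor \<open>1 / (n\<^sub>a-1)!\<close> is \<open>1 / \<Gamma>(n\<^sub>a)\<close>, which is 0 for \<open>n\<^sub>a = 0\<close>.
\<close>

definition kravchuk_kappa_eps :: "nat \<Rightarrow> (nat \<Rightarrow> real) \<Rightarrow> (nat \<Rightarrow> nat) \<Rightarrow> nat \<Rightarrow> real \<Rightarrow> real" where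
  "kravchuk_kappa_eps N p n a \<epsilon> =
     (-1) ^ (n a - 1) * Gamma (real (n 1) + real (n 2) - 1 + \<epsilon>)
      * rGamma (real (n a)) * rGamma (real (hat n a) + \<epsilon>) /
     (pochhammer (real N - real (n 1) - real (n 2) + 2) (n 1 + n 2 - 1)
      * (p a - hat p a) ^ (n 1 + n 2 - 1))"

text \<open>
  In the following, \<open>c\<close> stands for the parameter \<open>-n\<^sub>1-n\<^sub>2+2\<close>. In the double sum the ranges
  \<open>l < n\<^sub>a\<close> and \<open>m < n\<^sub>a - l\<close> are \<open>0 \<le> l \<le> n\<^sub>a - 1\<close> and \<open>0 \<le> m \<le> n\<^sub>a - 1 - l\<close>, empty for \<open>n\<^sub>a = 0\<close>.
\<close>

definition kravchuk_series ::
  "nat \<Rightarrow> (nat \<Rightarrow> real) \<Rightarrow> (nat \<Rightarrow> nat) \<Rightarrow> nat \<Rightarrow> real \<Rightarrow> real \<Rightarrow> real" where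
  "kravchuk_series N p n a c x =
     kampe_de_feriet [- real (n a) + 1, - real N] [- x] [] [c] [- real N] []
       ((p a - hat p a) / (p a * (1 - p a))) ((hat p a - p a) / (1 - p a))"

definition kravchuk_double_sum ::
  "nat \<Rightarrow> (nat \<Rightarrow> real) \<Rightarrow> (nat \<Rightarrow> nat) \<Rightarrow> nat \<Rightarrow> real \<Rightarrow> real \<Rightarrow> real" where
  "kravchuk_double_sum N p n a c x =
     (\<Sum>l<n a. \<Sum>m<n a - l.
        pochhammer (- real (n a) + 1) (l + m) * pochhammer (- real N) (l + m) /
        (fact l * fact m * pochhammer c (l + m) * pochhammer (- real N) l)
        * ((p a - hat p a) / (p a * (1 - p a))) ^ l * ((hat p a - p a) / (1 - p a)) ^ m
        * pochhammer (- x) l)"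

end

theory Submission
  imports Defs
begin

text \<open>
  Expand \<open>K\<^sub>a\<close> in the Kravchuk polynomials \<open>\<^sub>2F\<^sub>1(-t, -x; -N; 1/p\<^sub>a)\<close>, \<open>t < n\<^sub>a\<close>, with coefficients \<open>D\<^sub>t\<close>.
  By Chu-Vandermonde, the \<open>j\<close>-th moment of such a polynomial against \<open>(-N+x)\<^sub>j\<close> is
  \<open>(-N)\<^sub>j s\<^sub>a\<^sup>j (-j)\<^sub>t / (-N)\<^sub>t\<close> with \<open>s\<^sub>a = 1 - p\<^sub>a\<close>. Biorthogonality thus says that a sum of two
  exponential polynomials in \<open>j\<close>, with bases \<open>s\<^sub>1\<close> and \<open>s\<^sub>2\<close>, vanishes for \<open>j \<le> n\<^sub>1 + n\<^sub>2 - 2\<close> and has a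
  known value at \<open>j = n\<^sub>1 + n\<^sub>2 - 1\<close>. Pairing it with the coefficients of
  \<open>(z - s\<^sub>b)\<close> to the power \<open>n\<^sub>b\<close> times powers of \<open>z - s\<^sub>a\<close> leaves a triangular system whose solution
  is the coefficient sequence of \<open>(z - s\<^sub>b)\<close> to the power \<open>-n\<^sub>b\<close> expanded at \<open>s\<^sub>a\<close>. Collecting the
  double sum by \<open>t = l + m\<close> turns it into the same expansion.
\<close>

section \<open>Pochhammer polynomials, graded bases, Taylor coefficients and convolutions\<close>

lemma pochhammer_linear_nonzero:
  fixes a b :: "'a::field"
  shows "b \<noteq> 0 \<Longrightarrow> pochhammer [:a, b:] n \<noteq> 0"
  by (simp add: pochhammer_prod of_nat_poly)

lemma degree_pochhammer_linear:
  fixes a b :: "'a::field"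
  shows "b \<noteq> 0 \<Longrightarrow> degree (pochhammer [:a, b:] n) = n"
  by (simp add: pochhammer_prod of_nat_poly degree_prod_eq_sum_degree)

lemma lead_coeff_pochhammer_linear:
  fixes a b :: "'a::field"
  assumes "b \<noteq> 0"
  shows "coeff (pochhammer [:a, b:] n) n = b ^ n"
proof -
  have "lead_coeff (pochhammer [:a, b:] n) = b ^ n"
    unfolding pochhammer_prod lead_coeff_prod using assms by (simp add: of_nat_poly)
  then show ?thesis using degree_pochhammer_linear[OF assms] by simp
qed

lemma poly_pochhammer: "poly (pochhammer q n) x = pochhammer (poly q x) n"
  by (induction n) (simp_all add: pochhammer_Suc)

text \<open>Subtracting the multiple of \<open>f n\<close> that cancels the coefficient of degree
  \<open>n\<close> lowers the degree, and induction does the rest. The alternative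
  \<open>q = 0\<close> is the only one left for \<open>n = 0\<close>.\<close>

lemma poly_in_graded_span:
  fixes f :: "nat \<Rightarrow> 'a::field poly"
  assumes "\<And>t. t < n \<Longrightarrow> degree (f t) = t" "\<And>t. t < n \<Longrightarrow> f t \<noteq> 0" "q = 0 \<or> degree q < n"
  shows "\<exists>D. q = (\<Sum>t<n. smult (D t) (f t))"
  using assms
proof (induction n arbitrary: q)
  case 0
  then show ?case by simp
next
  case (Suc n)
  define d where "d = coeff q n / coeff (f n) n"
  define r where "r = q - smult d (f n)"
  have deg: "degree (f n) = n" and "f n \<noteq> 0" using Suc.prems by auto
  then have "coeff (f n) n \<noteq> 0" using leading_coeff_neq_0 by metis
  then have "coeff r n = 0" by (simp add: r_def d_def)
  moreover have "degree r \<le> n" unfolding r_def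
    using Suc.prems(3) deg by (intro degree_diff_le) auto
  ultimately have "r = 0 \<or> degree r < n"
    by (metis leading_coeff_0_iff nat_less_le)
  with Suc.IH Suc.prems obtain D where D: "r = (\<Sum>t<n. smult (D t) (f t))"
    by (metis less_SucI)
  have "q = (\<Sum>t<Suc n. smult ((D(n := d)) t) (f t))"
    using D by (simp add: r_def algebra_simps)
  then show ?case by blast
qed

text \<open>These are the Taylor coefficients of \<open>T\<close> at \<open>s\<close>. Pairing the
  coefficients of \<open>T\<close> with the sequence \<open>(j choose t) * s ^ (j - t)\<close> thus
  detects the order of vanishing of \<open>T\<close> at \<open>s\<close>. For \<open>j < t\<close>
  the binomial coefficient is zero, so the truncated exponent does no harm.\<close>

lemma coeff_pcompose_linear:
  fixes T :: "'a::comm_ring_1 poly"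
  assumes "degree T \<le> d"
  shows "coeff (pcompose T [:s, 1:]) t = (\<Sum>j\<le>d. coeff T j * (of_nat (j choose t) * s ^ (j - t)))"
proof -
  have "pcompose (monom c j) [:s, 1:] = smult c ([:s, 1:] ^ j)" for c j
    by (induction j) (simp_all add: monom_0 monom_Suc pcompose_pCons)
  then have "pcompose T [:s, 1:] = (\<Sum>j\<le>d. smult (coeff T j) ([:s, 1:] ^ j))"
    using arg_cong[OF poly_as_sum_of_monoms'[OF assms], of "\<lambda>q. pcompose q [:s, 1:]"]
    by (simp add: pcompose_sum)
  moreover have "coeff ([:s, 1:] ^ j) t = of_nat (j choose t) * s ^ (j - t)" for j
  proof (cases "t \<le> j")
    case True
    then show ?thesis by (simp add: coeff_linear_poly_power)
  next
    case False
    then show ?thesis by (simp add: coeff_eq_0 degree_linear_power binomial_eq_0)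
  qed
  ultimately show ?thesis by (simp add: coeff_sum)
qed

text \<open>A power series \<open>h\<close> with nonzero constant term can be divided out, here
  modulo terms of order \<open>n\<close>.\<close>

lemma convolution_cancel:
  fixes f g h :: "nat \<Rightarrow> 'a::field"
  assumes "\<And>r. r < n \<Longrightarrow> (\<Sum>k\<le>r. f k * h (r - k)) = (\<Sum>k\<le>r. g k * h (r - k))"
    and "h 0 \<noteq> 0" and "r < n"
  shows "f r = g r"
  using \<open>r < n\<close>
proof (induction r rule: less_induct)
  case (less r)
  have "(\<Sum>k<r. f k * h (r - k)) = (\<Sum>k<r. g k * h (r - k))"
    using less by (intro sum.cong) auto
  then show ?case using assms(1)[OF less.prems] \<open>h 0 \<noteq> 0\<close>
    by (simp add: lessThan_Suc_atMost[symmetric])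
qed

section \<open>Binomial weights, Kravchuk polynomials and their moments\<close>

lemma kravchuk_weight_eq:
  assumes "k \<le> N"
  shows "kravchuk_weight N p k = real (N choose k) * p ^ k * (1 - p) ^ (N - k)"
proof -
  have "Gamma (real k + 1) = fact k" using Gamma_fact[of k, where 'a = real] by (simp add: add.commute)
  moreover have "Gamma (real N - real k + 1) = fact (N - k)"
    using assms Gamma_fact[of "N - k", where 'a = real] by (simp add: add.commute of_nat_diff)
  ultimately show ?thesis using assms
    by (simp add: kravchuk_weight_def binomial_fact)
qed

text \<open>The first factor of either Pochhammer symbol is absorbed into the binomial coefficient,
  which lowers \<open>N\<close> by one; the boundary term \<open>k = N\<close> or
  \<open>k = 0\<close> drops out because that factor is zero there. For \<open>l + j > N\<close> the
  Pochhammer symbol on the right vanishes, whatever the truncated exponent.\<close>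

lemma binomial_moment:
  fixes p s :: real
  shows "(\<Sum>k\<le>N. pochhammer (- real N + real k) j * pochhammer (- real k) l
            * (real (N choose k) * p ^ k * s ^ (N - k)))
         = pochhammer (- real N) (l + j) * p ^ l * s ^ j * (p + s) ^ (N - (l + j))"
proof (induction l arbitrary: N)
  case 0
  show ?case
  proof (induction j arbitrary: N)
    case 0
    then show ?case by (simp add: binomial_ring)
  next
    case (Suc j)
    show ?case
    proof (cases N)
      case 0
      then show ?thesis by (simp add: pochhammer_0_left)
    next
      case (Suc M)
      have "(\<Sum>k\<le>N. pochhammer (- real N + real k) (Suc j) * (real (N choose k) * p ^ k * s ^ (N - k)))
         = (\<Sum>k\<le>M. pochhammer (- real N + real k) (Suc j) * (real (N choose k) * p ^ k * s ^ (N - k)))"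
        by (simp add: Suc pochhammer_0_left)
      also have "\<dots> = (\<Sum>k\<le>M. - real N * s * (pochhammer (- real M + real k) j * (real (M choose k) * p ^ k * s ^ (M - k))))"
      proof (rule sum.cong[OF refl])
        fix k assume k: "k \<in> {..M}"
        have c: "real (N - k) * real (N choose k) = real N * real (M choose k)"
          using binomial_absorb_comp[of N k] Suc by (metis diff_Suc_1 of_nat_mult)
        have "pochhammer (- real N + real k) (Suc j) = - real (N - k) * pochhammer (- real M + real k) j"
          using k Suc by (simp add: pochhammer_rec of_nat_diff algebra_simps)
        moreover have "s ^ (N - k) = s * s ^ (M - k)" using k Suc by (simp add: Suc_diff_le)
        ultimately have "pochhammer (- real N + real k) (Suc j) * (real (N choose k) * p ^ k * s ^ (N - k))
           = - (real (N - k) * real (N choose k)) * s * (pochhammer (- real M + real k) j * p ^ k * s ^ (M - k))"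
          by (simp add: algebra_simps)
        then show "pochhammer (- real N + real k) (Suc j) * (real (N choose k) * p ^ k * s ^ (N - k))
           = - real N * s * (pochhammer (- real M + real k) j * (real (M choose k) * p ^ k * s ^ (M - k)))"
          unfolding c by (simp add: algebra_simps)
      qed
      also have "\<dots> = - real N * s * (pochhammer (- real M) j * s ^ j * (p + s) ^ (M - j))"
        using Suc.IH[of M] unfolding sum_distrib_left[symmetric] by simp
      finally show ?thesis using Suc by (simp add: pochhammer_rec mult_ac)
    qed
  qed
next
  case (Suc l)
  show ?case
  proof (cases N)
    case 0
    then show ?thesis by (simp add: pochhammer_0_left)
  next
    case (Suc M)
    have "(\<Sum>k\<le>N. pochhammer (- real N + real k) j * pochhammer (- real k) (Suc l)
            * (real (N choose k) * p ^ k * s ^ (N - k)))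
       = (\<Sum>k\<le>M. pochhammer (- real N + real (Suc k)) j * pochhammer (- real (Suc k)) (Suc l)
            * (real (N choose Suc k) * p ^ Suc k * s ^ (N - Suc k)))"
      unfolding Suc by (subst sum.atMost_Suc_shift) (simp add: pochhammer_0_left)
    also have "\<dots> = (\<Sum>k\<le>M. - real N * p * (pochhammer (- real M + real k) j * pochhammer (- real k) l
            * (real (M choose k) * p ^ k * s ^ (M - k))))"
    proof (rule sum.cong[OF refl])
      fix k assume k: "k \<in> {..M}"
      have c: "real (Suc k) * real (N choose Suc k) = real N * real (M choose k)"
        using Suc_times_binomial[of k M] Suc by (metis of_nat_mult)
      have h1: "pochhammer (- real (Suc k)) (Suc l) = - real (Suc k) * pochhammer (- real k) l"
        by (simp add: pochhammer_rec algebra_simps)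
      have h2: "- real N + real (Suc k) = - real M + real k" using Suc by simp
      have h3: "N - Suc k = M - k" using Suc by simp
      have "pochhammer (- real N + real (Suc k)) j * pochhammer (- real (Suc k)) (Suc l)
            * (real (N choose Suc k) * p ^ Suc k * s ^ (N - Suc k))
         = - (real (Suc k) * real (N choose Suc k)) * p * (pochhammer (- real M + real k) j * pochhammer (- real k) l
            * (p ^ k * s ^ (M - k)))"
        unfolding h1 h2 h3 by (simp add: algebra_simps)
      then show "pochhammer (- real N + real (Suc k)) j * pochhammer (- real (Suc k)) (Suc l)
            * (real (N choose Suc k) * p ^ Suc k * s ^ (N - Suc k))
         = - real N * p * (pochhammer (- real M + real k) j * pochhammer (- real k) l
            * (real (M choose k) * p ^ k * s ^ (M - k)))"
        unfolding c by (simp add: algebra_simps)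
    qed
    also have "\<dots> = - real N * p * (pochhammer (- real M) (l + j) * p ^ l * s ^ j * (p + s) ^ (M - (l + j)))"
      unfolding sum_distrib_left[symmetric] Suc.IH ..
    finally show ?thesis using Suc by (simp add: pochhammer_rec mult_ac)
  qed
qed

text \<open>The Kravchuk polynomial \<open>\<^sub>2F\<^sub>1(-t, -x; -N; 1/p)\<close>, a polynomial of degree \<open>t\<close> only for \<open>t \<le> N\<close>.\<close>

definition kravchuk_poly :: "nat \<Rightarrow> real \<Rightarrow> nat \<Rightarrow> real poly" where
  "kravchuk_poly N p t =
     (\<Sum>l\<le>t. smult (pochhammer (- real t) l / (fact l * pochhammer (- real N) l * p ^ l))
                  (pochhammer [:0, -1:] l))"

lemma poly_kravchuk_poly:
  "poly (kravchuk_poly N p t) x =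
     (\<Sum>l\<le>t. pochhammer (- real t) l / (fact l * pochhammer (- real N) l * p ^ l) * pochhammer (- x) l)"
  by (simp add: kravchuk_poly_def poly_sum poly_pochhammer)

lemma degree_kravchuk_poly_le: "degree (kravchuk_poly N p t) \<le> t"
  unfolding kravchuk_poly_def
  by (rule degree_sum_le) (auto intro: order.trans[OF degree_smult_le] simp: degree_pochhammer_linear)

lemma coeff_kravchuk_poly:
  assumes "t \<le> N"
  shows "coeff (kravchuk_poly N p t) t = 1 / (pochhammer (- real N) t * p ^ t)"
proof -
  have "coeff (kravchuk_poly N p t) t =
      (\<Sum>l\<le>t. if l = t then pochhammer (- real t) t / (fact t * pochhammer (- real N) t * p ^ t) * (-1) ^ t else 0)"
    unfolding kravchuk_poly_def coeff_sum
  proof (intro sum.cong[OF refl])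
    fix l assume "l \<in> {..t}"
    moreover have "coeff (pochhammer [:0, - 1::real:] l) t = 0" if "l < t"
      using that by (intro coeff_eq_0) (simp add: degree_pochhammer_linear)
    ultimately show "coeff (smult (pochhammer (- real t) l / (fact l * pochhammer (- real N) l * p ^ l))
                  (pochhammer [:0, -1:] l)) t = (if l = t then pochhammer (- real t) t / (fact t * pochhammer (- real N) t * p ^ t) * (-1) ^ t else 0)"
      by (auto simp: lead_coeff_pochhammer_linear)
  qed
  also have "\<dots> = 1 / (pochhammer (- real N) t * p ^ t)"
    by (simp add: pochhammer_same flip: power_add mult_2)
  finally show ?thesis .
qed

lemma degree_kravchuk_poly:
  assumes "t \<le> N" "p \<noteq> 0"
  shows "degree (kravchuk_poly N p t) = t" and "kravchuk_poly N p t \<noteq> 0"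
proof -
  have "coeff (kravchuk_poly N p t) t \<noteq> 0"
    using assms by (simp add: coeff_kravchuk_poly pochhammer_of_nat_eq_0_iff)
  then show "degree (kravchuk_poly N p t) = t" "kravchuk_poly N p t \<noteq> 0"
    using degree_kravchuk_poly_le[of N p t] le_degree by (force intro: antisym)+
qed

text \<open>As \<open>(-j)_t = 0\<close> for \<open>j < t\<close>, this contains the orthogonality
  of the Kravchuk polynomial to all polynomials of degree less than \<open>t\<close>.\<close>

lemma kravchuk_poly_moment:
  assumes "t \<le> N" "p \<noteq> 0"
  shows "(\<Sum>k\<le>N. pochhammer (- real N + real k) j * (poly (kravchuk_poly N p t) (real k) * kravchuk_weight N p k))
       = pochhammer (- real N) j * (1 - p) ^ j * (pochhammer (- real j) t / pochhammer (- real N) t)"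
proof -
  define c where "c l = pochhammer (- real t) l / (fact l * pochhammer (- real N) l * p ^ l)" for l
  have "(\<Sum>k\<le>N. pochhammer (- real N + real k) j * (poly (kravchuk_poly N p t) (real k) * kravchuk_weight N p k))
      = (\<Sum>k\<le>N. \<Sum>l\<le>t. c l * (pochhammer (- real N + real k) j * pochhammer (- real k) l *
            (real (N choose k) * p ^ k * (1 - p) ^ (N - k))))"
    by (intro sum.cong) (simp_all add: poly_kravchuk_poly c_def kravchuk_weight_eq sum_distrib_left sum_distrib_right mult_ac)
  also have "\<dots> = (\<Sum>l\<le>t. c l * (pochhammer (- real N) (l + j) * p ^ l * (1 - p) ^ j))"
    unfolding sum.swap[of _ "{..t}"] sum_distrib_left[symmetric] binomial_moment by simp
  \<comment> \<open>Splitting \<open>(-N)_(l+j)\<close> as \<open>(-N)_j (-N+j)_l\<close> leaves a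
    terminating hypergeometric sum at 1 with parameters \<open>-t\<close>, \<open>-N+j\<close> and
    \<open>-N\<close>.\<close>
  also have "\<dots> = (\<Sum>l\<le>t. pochhammer (- real N) j * (1 - p) ^ j *
      (pochhammer (- real N + real j) l * pochhammer (- real t) l / (fact l * pochhammer (- real N) l)))"
    using assms(2) by (intro sum.cong) (simp_all add: c_def pochhammer_product' add.commute[of _ j])
  also have "\<dots> = pochhammer (- real N) j * (1 - p) ^ j *
      (\<Sum>l=0..t. pochhammer (- real N + real j) l * pochhammer (- real t) l / (fact l * pochhammer (- real N) l))"
    by (simp only: atLeast0AtMost sum_distrib_left)
  also have "(\<Sum>l=0..t. pochhammer (- real N + real j) l * pochhammer (- real t) l / (fact l * pochhammer (- real N) l))
     = pochhammer (- real j) t / pochhammer (- real N) t"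
    using Vandermonde_pochhammer[of t "- real N" "- real N + real j"] assms by simp
  finally show ?thesis .
qed

section \<open>Exponential polynomials with prescribed initial values\<close>

lemma pochhammer_neg_of_nat: "pochhammer (- real j) t = (-1) ^ t * fact t * real (j choose t)"
  by (simp add: binomial_gbinomial gbinomial_pochhammer mult_ac)

lemma gbinomial_uminus_pochhammer: "(- a :: real) gchoose k = (-1) ^ k * pochhammer a k / fact k"
  by (simp add: gbinomial_pochhammer)

text \<open>The sequence \<open>(j choose t) * s ^ (j - t)\<close> generates
  \<open>1 / (z - s)^(t+1)\<close> in powers of \<open>1/z\<close>. The prescribed values therefore
  say that the two sums are the partial fractions of \<open>A / ((z - sa)^na (z - sb)^nb)\<close>,
  and \<open>D t\<close> is the coefficient of \<open>(z - sa)^(-t-1)\<close> in it.\<close>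

lemma binomial_exponential_coefficients:
  fixes sa sb :: real
  assumes "sa \<noteq> sb" "1 \<le> na"
    and eq: "\<And>j. j < na + nb \<Longrightarrow> (\<Sum>t<na. D t * (real (j choose t) * sa ^ (j - t)))
          + (\<Sum>t<nb. E t * (real (j choose t) * sb ^ (j - t))) = (if j = na + nb - 1 then A else 0)"
    and t: "t < na"
  shows "D t = A * ((- real nb) gchoose (na - 1 - t)) / (sa - sb) ^ (nb + (na - 1 - t))"
proof -
  define M where "M = na - 1"
  define \<delta> where "\<delta> = sa - sb"
  have \<delta>: "\<delta> \<noteq> 0" using assms by (simp add: \<delta>_def)
  \<comment> \<open>\<open>h\<close> and \<open>g\<close> are the coefficients of
    \<open>(z + \<delta>)^nb\<close> and of \<open>A (z + \<delta>)^(-nb)\<close>, so their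
    convolution is \<open>A\<close> followed by zeros.\<close>
  define h where "h k = real (nb choose k) * \<delta> ^ nb / \<delta> ^ k" for k
  define g where "g k = A * ((- real nb) gchoose k) / \<delta> ^ (nb + k)" for k
  have g: "(\<Sum>k\<le>r. g k * h (r - k)) = (if r = 0 then A else 0)" for r
  proof -
    have "(\<Sum>k\<le>r. g k * h (r - k)) = (\<Sum>k\<le>r. A / \<delta> ^ r * (((- real nb) gchoose k) * (real nb gchoose (r - k))))"
    proof (intro sum.cong[OF refl])
      fix k assume "k \<in> {..r}"
      then have "\<delta> ^ r = \<delta> ^ k * \<delta> ^ (r - k)" by (simp flip: power_add)
      then show "g k * h (r - k) = A / \<delta> ^ r * (((- real nb) gchoose k) * (real nb gchoose (r - k)))"
        using \<delta> by (simp add: g_def h_def binomial_gbinomial power_add field_simps)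
    qed
    also have "\<dots> = A / \<delta> ^ r * (0 gchoose r)"
      using gbinomial_Vandermonde[of "- real nb" "real nb" r]
      by (simp only: atLeast0AtMost sum_distrib_left[symmetric]) simp
    also have "\<dots> = (if r = 0 then A else 0)" by (cases r) auto
    finally show ?thesis .
  qed
  have f: "(\<Sum>k\<le>r. D (M - k) * h (r - k)) = (if r = 0 then A else 0)" if r: "r < na" for r
  proof -
    define i where "i = M - r"
    \<comment> \<open>Pairing the equations with the coefficients of \<open>T\<close> removes the \<open>E\<close>-part, because \<open>T\<close>
      vanishes to order \<open>nb\<close> at \<open>sb\<close>; the Taylor coefficients of \<open>T\<close> at \<open>sa\<close> give a
      triangular system for \<open>D\<close>.\<close>
    define T where "T = [:- sb, 1:] ^ nb * [:- sa, 1:] ^ i"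
    have iM: "nb + i \<le> na + nb - 1" using r by (simp add: i_def M_def)
    have degT: "degree T = nb + i"
      by (simp add: T_def degree_mult_eq degree_linear_power)
    then have degle: "degree T \<le> na + nb - 1" using iM by simp
    \<comment> \<open>The degree of \<open>T\<close> is \<open>na + nb - 1 - r\<close>, so the one
      equation with right-hand side \<open>A\<close> enters only for \<open>r = 0\<close>.\<close>
    have "coeff T (nb + i) = 1"
      using coeff_mult_degree_sum[of "[:- sb, 1:] ^ nb" "[:- sa, 1:] ^ i"]
      by (simp add: T_def degree_linear_power coeff_linear_power)
    moreover have "na + nb - 1 = nb + i" if "r = 0"
      using that \<open>1 \<le> na\<close> by (simp add: i_def M_def)
    moreover have "coeff T (na + nb - 1) = 0" if "r \<noteq> 0"
      using that degT r by (intro coeff_eq_0) (simp add: i_def M_def)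
    ultimately have top: "coeff T (na + nb - 1) = (if r = 0 then 1 else 0)" by auto
    have pow: "pcompose (q ^ m) v = (pcompose q v) ^ m" for q v :: "real poly" and m
      by (induction m) (simp_all add: pcompose_mult pcompose_1)
    have Ta: "coeff (pcompose T [:sa, 1:]) t = (if t < i then 0 else h (t - i))" for t
    proof -
      have "pcompose T [:sa, 1:] = monom 1 i * [:\<delta>, 1:] ^ nb"
        by (simp add: T_def pcompose_mult pow pcompose_pCons \<delta>_def monom_altdef algebra_simps)
      moreover have "coeff ([:\<delta>, 1:] ^ nb) k = h k" for k
      proof (cases "k \<le> nb")
        case True
        then show ?thesis using \<delta> by (simp add: coeff_linear_poly_power h_def power_diff)
      next
        case False
        then show ?thesis by (simp add: coeff_eq_0 degree_linear_power h_def binomial_eq_0)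
      qed
      ultimately show ?thesis by (simp add: coeff_monom_mult)
    qed
    have Tb: "coeff (pcompose T [:sb, 1:]) t = 0" if "t < nb" for t
    proof -
      have "pcompose T [:sb, 1:] = monom 1 nb * [:- \<delta>, 1:] ^ i"
        by (simp add: T_def pcompose_mult pow pcompose_pCons \<delta>_def monom_altdef algebra_simps)
      then show ?thesis using that by (simp add: coeff_monom_mult)
    qed
    have "(\<Sum>j\<le>na + nb - 1. coeff T j * ((\<Sum>t<na. D t * (real (j choose t) * sa ^ (j - t)))
          + (\<Sum>t<nb. E t * (real (j choose t) * sb ^ (j - t)))))
        = (\<Sum>j\<le>na + nb - 1. coeff T j * (if j = na + nb - 1 then A else 0))"
      using eq \<open>1 \<le> na\<close> by (intro sum.cong) auto
    also have "\<dots> = (if r = 0 then A else 0)"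
      using top by (simp add: if_distrib[of "\<lambda>x. _ * x"] cong: if_cong)
    also have "(\<Sum>j\<le>na + nb - 1. coeff T j * ((\<Sum>t<na. D t * (real (j choose t) * sa ^ (j - t)))
          + (\<Sum>t<nb. E t * (real (j choose t) * sb ^ (j - t)))))
       = (\<Sum>t<na. D t * (\<Sum>j\<le>na + nb - 1. coeff T j * (real (j choose t) * sa ^ (j - t))))
       + (\<Sum>t<nb. E t * (\<Sum>j\<le>na + nb - 1. coeff T j * (real (j choose t) * sb ^ (j - t))))"
      unfolding distrib_left sum.distrib sum_distrib_left
      by (intro arg_cong2[where f = "(+)"]; subst sum.swap; simp add: mult_ac)
    \<comment> \<open>After the exchange of summations the inner sums over \<open>j\<close> are
      Taylor coefficients of \<open>T\<close> at \<open>sa\<close> and \<open>sb\<close>.\<close>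
    also have "\<dots> = (\<Sum>t<na. D t * coeff (pcompose T [:sa, 1:]) t)
        + (\<Sum>t<nb. E t * coeff (pcompose T [:sb, 1:]) t)"
      by (simp add: coeff_pcompose_linear[OF degle])
    also have "\<dots> = (\<Sum>t<na. if t < i then 0 else D t * h (t - i))"
      by (simp add: Ta Tb if_distrib[of "\<lambda>x. _ * x"] cong: if_cong)
    also have "\<dots> = (\<Sum>t\<in>{i..M}. D t * h (t - i))"
      using \<open>1 \<le> na\<close> by (intro sum.mono_neutral_cong_right) (auto simp: M_def)
    also have "\<dots> = (\<Sum>k\<le>r. D (M - k) * h (r - k))"
      using r by (intro sum.reindex_bij_witness[of _ "\<lambda>k. M - k" "\<lambda>t. M - t"])
        (auto simp: i_def M_def add.commute)
    finally show ?thesis .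
  qed
  have "D (M - (M - t)) = g (M - t)"
    by (rule convolution_cancel[of na "\<lambda>k. D (M - k)" h g])
      (use f g \<delta> t in \<open>auto simp: h_def M_def\<close>)
  then show ?thesis using t by (simp add: g_def M_def \<delta>_def)
qed

section \<open>Kravchuk expansion of a polynomial of type I\<close>

text \<open>The bases are \<open>1 - pa\<close> and \<open>1 - pb\<close>, with difference
  \<open>pb - pa\<close>. The bound on \<open>na + nb\<close> keeps \<open>(-N)_j\<close> nonzero in
  every equation, which can then be divided by it. Separate names for the two indices let one
  statement serve \<open>a = 1\<close> and \<open>a = 2\<close>.\<close>

lemma type_I_expansion:
  fixes pa pb :: real
  assumes p: "0 < pa" "pa < 1" "0 < pb" "pb < 1" "pa \<noteq> pb"
    and n: "1 \<le> na" "na + nb \<le> N + 1"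
    and Ka: "Ka = 0 \<or> degree Ka < na" and Kb: "Kb = 0 \<or> degree Kb < nb"
    and moments: "\<And>j. j < na + nb \<Longrightarrow>
      (\<Sum>k\<le>N. pochhammer (- real N + real k) j *
         (poly Ka (real k) * kravchuk_weight N pa k + poly Kb (real k) * kravchuk_weight N pb k))
      = (if j = na + nb - 1 then 1 else 0)"
  shows "poly Ka x = (\<Sum>t<na. (- real nb gchoose (na - 1 - t))
      / (pochhammer (- real N) (na + nb - 1) * (pb - pa) ^ (nb + (na - 1 - t)))
      * ((-1) ^ t * pochhammer (- real N) t / (fact t * (1 - pa) ^ t)) * poly (kravchuk_poly N pa t) x)"
proof -
  obtain D where D: "Ka = (\<Sum>t<na. smult (D t) (kravchuk_poly N pa t))"
    using poly_in_graded_span[of na "kravchuk_poly N pa", OF _ _ Ka] degree_kravchuk_poly[of _ N pa] p n by auto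
  obtain E where E: "Kb = (\<Sum>t<nb. smult (E t) (kravchuk_poly N pb t))"
    using poly_in_graded_span[of nb "kravchuk_poly N pb", OF _ _ Kb] degree_kravchuk_poly[of _ N pb] p n by auto
  \<comment> \<open>\<open>c q t\<close> converts the moment
    \<open>(1 - q)^j (-j)_t / (-N)_t\<close> into \<open>(j choose t) * (1 - q) ^ (j - t)\<close>;
    both vanish for \<open>j < t\<close>.\<close>
  define c where "c q t = (-1) ^ t * fact t * (1 - q) ^ t / pochhammer (- real N) t" for q :: real and t
  have mom: "(\<Sum>k\<le>N. pochhammer (- real N + real k) j * (poly (\<Sum>t<m. smult (C t) (kravchuk_poly N q t)) (real k) * kravchuk_weight N q k))
     = pochhammer (- real N) j * (\<Sum>t<m. C t * c q t * (real (j choose t) * (1 - q) ^ (j - t)))"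
    if "0 < q" "m \<le> N + 1" for q m j and C :: "nat \<Rightarrow> real"
  proof -
    have "(\<Sum>k\<le>N. pochhammer (- real N + real k) j * (poly (\<Sum>t<m. smult (C t) (kravchuk_poly N q t)) (real k) * kravchuk_weight N q k))
       = (\<Sum>k\<le>N. \<Sum>t<m. C t * (pochhammer (- real N + real k) j * (poly (kravchuk_poly N q t) (real k) * kravchuk_weight N q k)))"
      by (simp add: poly_sum sum_distrib_left sum_distrib_right mult_ac)
    also have "\<dots> = (\<Sum>t<m. C t * (\<Sum>k\<le>N. pochhammer (- real N + real k) j * (poly (kravchuk_poly N q t) (real k) * kravchuk_weight N q k)))"
      by (subst sum.swap) (simp only: sum_distrib_left)
    also have "\<dots> = (\<Sum>t<m. pochhammer (- real N) j * (C t * c q t * (real (j choose t) * (1 - q) ^ (j - t))))"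
    proof (rule sum.cong[OF refl])
      fix t assume t: "t \<in> {..<m}"
      have "pochhammer (- real j) t * (1 - q) ^ j = (-1) ^ t * fact t * (1 - q) ^ t * (real (j choose t) * (1 - q) ^ (j - t))"
        by (cases "t \<le> j") (simp_all add: pochhammer_neg_of_nat binomial_eq_0 flip: power_add)
      moreover have "t \<le> N" "q \<noteq> 0" using t that by auto
      ultimately show "C t * (\<Sum>k\<le>N. pochhammer (- real N + real k) j * (poly (kravchuk_poly N q t) (real k) * kravchuk_weight N q k))
         = pochhammer (- real N) j * (C t * c q t * (real (j choose t) * (1 - q) ^ (j - t)))"
        unfolding kravchuk_poly_moment[OF \<open>t \<le> N\<close> \<open>q \<noteq> 0\<close>] c_def by (simp add: mult_ac)
    qed
    finally show ?thesis by (simp only: sum_distrib_left)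
  qed
  define A where "A = 1 / pochhammer (- real N) (na + nb - 1)"
  have coeffs: "D t * c pa t = A * (- real nb gchoose (na - 1 - t)) / ((1 - pa) - (1 - pb)) ^ (nb + (na - 1 - t))"
    if "t < na" for t
  proof (rule binomial_exponential_coefficients[where E = "\<lambda>t. E t * c pb t"])
    fix j assume j: "j < na + nb"
    have "pochhammer (- real N) j * ((\<Sum>t<na. D t * c pa t * (real (j choose t) * (1 - pa) ^ (j - t)))
        + (\<Sum>t<nb. E t * c pb t * (real (j choose t) * (1 - pb) ^ (j - t))))
        = (if j = na + nb - 1 then 1 else 0)"
    proof -
      have "na \<le> N + 1" "nb \<le> N + 1" using n by auto
      from moments[OF j, unfolded distrib_left sum.distrib D E
          mom[OF p(1) this(1)] mom[OF p(3) this(2)]] show ?thesis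
        unfolding distrib_left .
    qed
    moreover have "pochhammer (- real N) j \<noteq> 0"
      using j n by (simp add: pochhammer_of_nat_eq_0_iff)
    ultimately show "(\<Sum>t<na. D t * c pa t * (real (j choose t) * (1 - pa) ^ (j - t)))
        + (\<Sum>t<nb. E t * c pb t * (real (j choose t) * (1 - pb) ^ (j - t)))
        = (if j = na + nb - 1 then A else 0)"
      by (auto simp: A_def eq_divide_eq mult.commute)
  qed (use p n that in auto)
  have "D t = (- real nb gchoose (na - 1 - t))
      / (pochhammer (- real N) (na + nb - 1) * (pb - pa) ^ (nb + (na - 1 - t)))
      * ((-1) ^ t * pochhammer (- real N) t / (fact t * (1 - pa) ^ t))" if "t < na" for t
  proof -
    have "c pa t * ((-1) ^ t * pochhammer (- real N) t / (fact t * (1 - pa) ^ t)) = 1"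
      using that p n by (simp add: c_def pochhammer_of_nat_eq_0_iff)
    then have "D t = (D t * c pa t) * ((-1) ^ t * pochhammer (- real N) t / (fact t * (1 - pa) ^ t))"
      by (simp only: mult.assoc mult_1_right)
    then show ?thesis unfolding coeffs[OF that] by (simp add: A_def)
  qed
  then show ?thesis by (subst D) (simp add: poly_sum)
qed

section \<open>Moments of the form of type I from biorthogonality\<close>

text \<open>The symbol \<open>(0)_(l-r)\<close> leaves only \<open>r = l\<close>. The multi-index
  \<open>(m, 0)\<close> suffices for extracting the normalization.\<close>

lemma kravchuk_II_0_right:
  "kravchuk_II N p m 0 x = p 1 ^ m * pochhammer (- real N) m * poly (kravchuk_poly N (p 1) m) x"
proof -
  have "(\<Sum>r = 0..l. pochhammer (- real m) r * pochhammer (- real 0) (l - r) / (fact r * fact (l - r))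
        * (1 / p 1 ^ r) * (1 / p 2 ^ (l - r)) * (pochhammer (- x) l / pochhammer (- real N) l))
      = pochhammer (- real m) l / (fact l * pochhammer (- real N) l * p 1 ^ l) * pochhammer (- x) l" for l
  proof -
    have "(\<Sum>r = 0..l. pochhammer (- real m) r * pochhammer (- real 0) (l - r) / (fact r * fact (l - r))
        * (1 / p 1 ^ r) * (1 / p 2 ^ (l - r)) * (pochhammer (- x) l / pochhammer (- real N) l))
      = (\<Sum>r\<in>{l}. pochhammer (- real m) r * pochhammer (- real 0) (l - r) / (fact r * fact (l - r))
        * (1 / p 1 ^ r) * (1 / p 2 ^ (l - r)) * (pochhammer (- x) l / pochhammer (- real N) l))"
      by (rule sum.mono_neutral_right) (auto simp: pochhammer_0_left)
    then show ?thesis by simp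
  qed
  then show ?thesis by (simp add: kravchuk_II_def poly_kravchuk_poly atLeast0AtMost)
qed

text \<open>For the top value \<open>j = n 1 + n 2 - 1\<close>, the monic polynomial of type II with
  index \<open>(j, 0)\<close> is expanded in the symbols \<open>(x - N)_t\<close>. The moments with
  \<open>t < j\<close> vanish, so the normalization 1 is the moment of order \<open>j\<close>
  itself.\<close>

lemma kravchuk_type_I_moments:
  assumes K: "kravchuk_type_I N p n K" and "p 1 \<noteq> 0" and n: "n 1 + n 2 \<le> N + 1" and j: "j < n 1 + n 2"
  shows "(\<Sum>k\<le>N. pochhammer (- real N + real k) j * type_I_form N p K k)
    = (if j = n 1 + n 2 - 1 then 1 else 0)"
proof (cases "j = n 1 + n 2 - 1")
  case False
  then show ?thesis using K j unfolding kravchuk_type_I_def by (auto simp: atLeast0AtMost)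
next
  case True
  define R where "R = smult (p 1 ^ j * pochhammer (- real N) j) (kravchuk_poly N (p 1) j)"
  have "j \<le> N" using j n by simp
  have "degree R < Suc j"
    unfolding R_def using degree_kravchuk_poly_le[of N "p 1" j] by (intro le_imp_less_Suc order.trans[OF degree_smult_le])
  then obtain D where D: "R = (\<Sum>t<Suc j. smult (D t) (pochhammer [:- real N, 1:] t))"
    using poly_in_graded_span[of "Suc j" "pochhammer [:- real N, 1:]" R]
    by (auto simp: degree_pochhammer_linear pochhammer_linear_nonzero)
  \<comment> \<open>Both \<open>R\<close> and \<open>(x - N)_j\<close> are monic of degree
    \<open>j\<close>, which forces \<open>D j = 1\<close>.\<close>
  have "coeff R j = 1" using \<open>j \<le> N\<close> assms(2)
    by (simp add: R_def coeff_kravchuk_poly pochhammer_of_nat_eq_0_iff)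
  moreover have "coeff R j = (\<Sum>t<Suc j. if t = j then D j else 0)"
    unfolding D coeff_sum
  proof (rule sum.cong[OF refl])
    fix t assume "t \<in> {..<Suc j}"
    moreover have "coeff (pochhammer [:- real N, 1:] t) j = 0" if "t < j"
      using that by (intro coeff_eq_0) (simp add: degree_pochhammer_linear)
    ultimately show "coeff (smult (D t) (pochhammer [:- real N, 1:] t)) j = (if t = j then D j else 0)"
      by (auto simp: lead_coeff_pochhammer_linear)
  qed
  ultimately have Dj: "D j = 1" by simp
  define L where "L t = (\<Sum>k\<le>N. pochhammer (- real N + real k) t * type_I_form N p K k)" for t
  have "(\<Sum>k = 0..N. kravchuk_II N p j 0 (real k) * type_I_form N p K k) = 1"
    using K \<open>j \<le> N\<close> True j unfolding kravchuk_type_I_def by fastforce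
  moreover have "kravchuk_II N p j 0 y = (\<Sum>t<Suc j. D t * pochhammer (- real N + y) t)" for y
    using arg_cong[OF D, of "\<lambda>q. poly q y"]
    by (simp add: kravchuk_II_0_right R_def poly_sum poly_pochhammer)
  ultimately have "1 = (\<Sum>k\<le>N. \<Sum>t<Suc j. D t * (pochhammer (- real N + real k) t * type_I_form N p K k))"
    by (simp only: sum_distrib_right atLeast0AtMost mult.assoc)
  also have "\<dots> = (\<Sum>t<Suc j. D t * L t)"
    by (subst sum.swap) (simp only: L_def sum_distrib_left)
  also have "\<dots> = (\<Sum>t<Suc j. if t = j then L j else 0)"
  proof (rule sum.cong[OF refl])
    fix t assume "t \<in> {..<Suc j}"
    moreover have "L t = 0" if "t < j"
      using K True that unfolding kravchuk_type_I_def L_def by (auto simp: atLeast0AtMost)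
    ultimately show "D t * L t = (if t = j then L j else 0)" using Dj by auto
  qed
  finally show ?thesis using True by (simp add: L_def)
qed

section \<open>The series as a finite sum over Kravchuk polynomials\<close>

text \<open>The symbol \<open>(1 - n a)_(l+m)\<close> vanishes outside the triangle
  \<open>l + m < n a\<close>, for every value of \<open>c\<close>. For \<open>n a = 0\<close> this
  parameter would be 1 and cut nothing off.\<close>

lemma kravchuk_series_eq_double_sum:
  assumes "1 \<le> n a"
  shows "kravchuk_series N p n a c x = kravchuk_double_sum N p n a c x"
proof -
  define X where "X = (p a - hat p a) / (p a * (1 - p a))"
  define Y where "Y = (hat p a - p a) / (1 - p a)"
  define f where "f = (\<lambda>(l, m). pochhammer (- real (n a) + 1) (l + m) * pochhammer (- real N) (l + m) /
        (fact l * fact m * pochhammer c (l + m) * pochhammer (- real N) l)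
        * X ^ l * Y ^ m * pochhammer (- x) l)"
  define S where "S = (SIGMA l:{..<n a}. {..<n a - l})"
  have zero: "pochhammer (1 - real (n a)) k = 0" if "n a \<le> k" for k
  proof -
    have "1 - real (n a) = - real (n a - 1)" using assms by (simp add: of_nat_diff)
    then show ?thesis using assms that by (metis pochhammer_of_nat_eq_0_iff diff_less less_le_trans less_one)
  qed
  have "kravchuk_series N p n a c x = infsum f UNIV"
    unfolding kravchuk_series_def kampe_de_feriet_def f_def X_def[symmetric] Y_def[symmetric]
    by (intro infsum_cong) (auto simp: poch_list_def divide_inverse mult_ac)
  also have "\<dots> = infsum f S"
  proof (rule infsum_cong_neutral)
    fix y assume "y \<in> UNIV - S"
    then obtain l m where "y = (l, m)" "n a \<le> l + m"
      by (cases y) (auto simp: S_def not_less)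
    then show "f y = 0" by (simp add: f_def zero)
  qed auto
  also have "\<dots> = sum f S" by (simp add: S_def)
  also have "\<dots> = kravchuk_double_sum N p n a c x"
    unfolding S_def f_def kravchuk_double_sum_def X_def[symmetric] Y_def[symmetric]
    by (subst sum.Sigma) auto
  finally show ?thesis .
qed

text \<open>The two arguments of the series have ratio \<open>-1 / p a\<close>. On the diagonal
  \<open>t = l + m\<close>, \<open>1 / (t - l)!\<close> equals \<open>(-1)^l (-t)_l / t!\<close>,
  and the signs cancel, so the inner sum over \<open>l\<close> is a Kravchuk polynomial.\<close>

lemma kravchuk_double_sum_eq:
  assumes "0 < p a" "p a < 1"
  shows "kravchuk_double_sum N p n a c x = (\<Sum>t<n a. pochhammer (- real (n a) + 1) t / pochhammer c t
     * ((hat p a - p a) ^ t / (1 - p a) ^ t * pochhammer (- real N) t / fact t * poly (kravchuk_poly N (p a) t) x))"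
proof -
  define \<delta> where "\<delta> = hat p a - p a"
  define g where "g l m = pochhammer (- real (n a) + 1) (l + m) * pochhammer (- real N) (l + m) /
        (fact l * fact m * pochhammer c (l + m) * pochhammer (- real N) l)
        * ((p a - hat p a) / (p a * (1 - p a))) ^ l * ((hat p a - p a) / (1 - p a)) ^ m * pochhammer (- x) l" for l m
  have S: "(SIGMA l:{..<n a}. {..<n a - l}) = {(l, m). l + m < n a}" by auto
  have "kravchuk_double_sum N p n a c x = (\<Sum>(l, m)\<in>{(l, m). l + m < n a}. g l m)"
    unfolding kravchuk_double_sum_def g_def[symmetric] S[symmetric] by (subst sum.Sigma) auto
  also have "\<dots> = (\<Sum>t<n a. \<Sum>l\<le>t. g l (t - l))"
    by (rule sum.triangle_reindex)
  also have "\<dots> = (\<Sum>t<n a. \<Sum>l\<le>t. pochhammer (- real (n a) + 1) t / pochhammer c t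
     * (\<delta> ^ t / (1 - p a) ^ t * pochhammer (- real N) t / fact t) *
      (pochhammer (- real t) l / (fact l * pochhammer (- real N) l * p a ^ l) * pochhammer (- x) l))"
  proof (intro sum.cong[OF refl])
    fix t l :: nat assume "l \<in> {..t}"
    then have l: "l \<le> t" by simp
    have "(p a - hat p a) / (p a * (1 - p a)) = (-1) * \<delta> / (p a * (1 - p a))" by (simp add: \<delta>_def)
    then have X: "((p a - hat p a) / (p a * (1 - p a))) ^ l = (-1) ^ l * \<delta> ^ l / (p a ^ l * (1 - p a) ^ l)"
      by (simp only: power_divide power_mult_distrib)
    have T: "\<delta> ^ t = \<delta> ^ l * \<delta> ^ (t - l)" "(1 - p a) ^ t = (1 - p a) ^ l * (1 - p a) ^ (t - l)"
      using l by (simp_all flip: power_add)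
    have P: "pochhammer (- real t) l = (-1) ^ l * fact t / fact (t - l)"
      using l by (simp add: pochhammer_neg_of_nat binomial_fact)
    have F: "fact t * (inverse (fact t) * z) = z" for z :: real by simp
    show "g l (t - l) = pochhammer (- real (n a) + 1) t / pochhammer c t
     * (\<delta> ^ t / (1 - p a) ^ t * pochhammer (- real N) t / fact t) *
      (pochhammer (- real t) l / (fact l * pochhammer (- real N) l * p a ^ l) * pochhammer (- x) l)"
      using l unfolding g_def \<delta>_def[symmetric] X T P unfolding power_divide
      by (simp add: F divide_inverse mult_ac)
  qed
  finally show ?thesis
    unfolding \<delta>_def sum_distrib_left[symmetric] poly_kravchuk_poly by (simp only: mult.assoc)
qed

section \<open>Cancellation of the Gamma functions and the limit\<close>

text \<open>With \<open>z = hat n a + \<epsilon>\<close> and \<open>M = n a - 1\<close>, the Gamma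
  quotient is \<open>(z)_M\<close> and the lower parameter is \<open>-(z + M - 1)\<close>. Up to
  sign its Pochhammer symbol consists of the last \<open>t\<close> factors of \<open>(z)_M\<close>;
  cancelling them leaves \<open>(z)_(M-t)\<close>.\<close>

lemma kravchuk_kappa_eps_pochhammer:
  assumes a: "a \<in> {1, 2}" and t: "t < n a" and e: "real (hat n a) + \<epsilon> \<notin> \<int>\<^sub>\<le>\<^sub>0"
  shows "kravchuk_kappa_eps N p n a \<epsilon> * (pochhammer (- real (n a) + 1) t
          / pochhammer (- real (n 1) - real (n 2) + 2 - \<epsilon>) t)
    = (-1) ^ (n a - 1) * pochhammer (real (hat n a) + \<epsilon>) (n a - 1 - t) /
      (fact (n a - 1 - t) * pochhammer (real N - real (n 1) - real (n 2) + 2) (n 1 + n 2 - 1)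
       * (p a - hat p a) ^ (n 1 + n 2 - 1))"
proof -
  define M where "M = n a - 1"
  define z where "z = real (hat n a) + \<epsilon>"
  have na: "real (n a) = real M + 1" "n a = Suc M" and tM: "t \<le> M" using t by (simp_all add: M_def)
  have sum: "real (n 1) + real (n 2) = real (n a) + real (hat n a)" using a by (auto simp: hat_def)
  have gam: "Gamma (real (n 1) + real (n 2) - 1 + \<epsilon>) * rGamma z = pochhammer z M"
  proof -
    have "real (n 1) + real (n 2) - 1 + \<epsilon> = z + real M" using sum unfolding na z_def by simp
    then show ?thesis using pochhammer_Gamma[of z M] e unfolding z_def[symmetric]
      by (simp only: rGamma_inverse_Gamma divide_inverse not_False_eq_True)
  qed
  have split: "pochhammer z M = pochhammer z (M - t) * pochhammer (z + real (M - t)) t"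
    using pochhammer_product[of "M - t" M z] tM by simp
  have denom: "pochhammer (- real (n 1) - real (n 2) + 2 - \<epsilon>) t = (-1) ^ t * pochhammer (z + real (M - t)) t"
  proof -
    have "- real (n 1) - real (n 2) + 2 - \<epsilon> = - (z + real M - 1)"
      using sum unfolding na z_def by simp
    moreover have "(z + real M - 1) - real t + 1 = z + real (M - t)"
      using of_nat_diff[OF tM, where 'a = real] by linarith
    ultimately show ?thesis using pochhammer_minus[of "z + real M - 1" t] by (simp only:)
  qed
  \<comment> \<open>A vanishing cancelled factor would make \<open>z\<close> a nonpositive
    integer.\<close>
  have nz: "pochhammer (z + real (M - t)) t \<noteq> 0"
  proof
    assume "pochhammer (z + real (M - t)) t = 0"
    then obtain k where "z + real (M - t) = - real k" by (auto simp: pochhammer_eq_0_iff)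
    then have "z = - real (k + (M - t))" by simp
    then show False using e unfolding z_def[symmetric] by (metis minus_of_nat_in_nonpos_Ints)
  qed
  have fac: "rGamma (real (n a)) = 1 / fact M"
    using Gamma_fact[of M, where 'a = real] na by (simp add: rGamma_inverse_Gamma add.commute divide_inverse)
  have num: "pochhammer (- real (n a) + 1) t = (-1) ^ t * fact M / fact (M - t)"
    using tM pochhammer_neg_of_nat[of M t] by (simp add: na binomial_fact)
  define R where "R = pochhammer (real N - real (n 1) - real (n 2) + 2) (n 1 + n 2 - 1) * (p a - hat p a) ^ (n 1 + n 2 - 1)"
  have "kravchuk_kappa_eps N p n a \<epsilon> = (-1) ^ M * (Gamma (real (n 1) + real (n 2) - 1 + \<epsilon>) * rGamma z) * rGamma (real (n a)) / R"
    unfolding kravchuk_kappa_eps_def z_def M_def R_def by (simp only: mult_ac)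
  then have kappa: "kravchuk_kappa_eps N p n a \<epsilon> =
      (-1) ^ M * (pochhammer z (M - t) * pochhammer (z + real (M - t)) t) * (1 / fact M) / R"
    by (simp only: gam fac split)
  show ?thesis
    using nz unfolding kappa denom num z_def[symmetric] M_def[symmetric] mult.assoc R_def[symmetric]
    by simp
qed

text \<open>
  The product of \<open>\<kappa>\<^sub>a\<close> and the series after cancelling the Gamma functions, polynomial in \<open>\<epsilon>\<close> and
  hence also meaningful at \<open>\<epsilon> = 0\<close> when \<open>n\<^sub>1 = 0\<close> or \<open>n\<^sub>2 = 0\<close>.
\<close>

definition kravchuk_limit_sum :: "nat \<Rightarrow> (nat \<Rightarrow> real) \<Rightarrow> (nat \<Rightarrow> nat) \<Rightarrow> nat \<Rightarrow> real \<Rightarrow> real \<Rightarrow> real" where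
  "kravchuk_limit_sum N p n a \<epsilon> x =
    (\<Sum>t<n a. (-1) ^ (n a - 1) * pochhammer (real (hat n a) + \<epsilon>) (n a - 1 - t) /
      (fact (n a - 1 - t) * pochhammer (real N - real (n 1) - real (n 2) + 2) (n 1 + n 2 - 1)
       * (p a - hat p a) ^ (n 1 + n 2 - 1))
     * ((hat p a - p a) ^ t / (1 - p a) ^ t * pochhammer (- real N) t / fact t * poly (kravchuk_poly N (p a) t) x))"

lemma kravchuk_kappa_eps_double_sum:
  assumes a: "a \<in> {1, 2}" and pa: "0 < p a" "p a < 1" and e: "real (hat n a) + \<epsilon> \<notin> \<int>\<^sub>\<le>\<^sub>0"
  shows "kravchuk_kappa_eps N p n a \<epsilon> * kravchuk_double_sum N p n a (- real (n 1) - real (n 2) + 2 - \<epsilon>) x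
    = kravchuk_limit_sum N p n a \<epsilon> x"
  unfolding kravchuk_double_sum_eq[where p = p and a = a, OF pa] kravchuk_limit_sum_def sum_distrib_left
proof (rule sum.cong[OF refl])
  fix t assume "t \<in> {..<n a}"
  then have t: "t < n a" by simp
  show "kravchuk_kappa_eps N p n a \<epsilon> * (pochhammer (- real (n a) + 1) t
        / pochhammer (- real (n 1) - real (n 2) + 2 - \<epsilon>) t *
       ((hat p a - p a) ^ t / (1 - p a) ^ t * pochhammer (- real N) t / fact t * poly (kravchuk_poly N (p a) t) x))
    = (-1) ^ (n a - 1) * pochhammer (real (hat n a) + \<epsilon>) (n a - 1 - t) /
      (fact (n a - 1 - t) * pochhammer (real N - real (n 1) - real (n 2) + 2) (n 1 + n 2 - 1)
       * (p a - hat p a) ^ (n 1 + n 2 - 1))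
     * ((hat p a - p a) ^ t / (1 - p a) ^ t * pochhammer (- real N) t / fact t * poly (kravchuk_poly N (p a) t) x)"
    unfolding kravchuk_kappa_eps_pochhammer[OF a t e, of N p, symmetric] by (rule mult.assoc[symmetric])
qed

lemma tendsto_kravchuk_limit_sum:
  "((\<lambda>\<epsilon>. kravchuk_limit_sum N p n a \<epsilon> x) \<longlongrightarrow> kravchuk_limit_sum N p n a 0 x) (at 0)"
proof -
  have "((\<lambda>\<epsilon>. pochhammer (h + \<epsilon>) k) \<longlongrightarrow> pochhammer (h + 0) k) (at 0)" for h :: real and k
    unfolding pochhammer_prod by (intro tendsto_intros)
  then show ?thesis
    unfolding kravchuk_limit_sum_def divide_inverse by (intro tendsto_sum tendsto_mult tendsto_const)
qed

section \<open>Identification of the polynomials of type I\<close>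

text \<open>The two expansions agree term by term: reversing \<open>(-N)_(n 1 + n 2 - 1)\<close> and
  replacing \<open>p b - p a\<close> by \<open>p a - p b\<close> produce the same sign. For
  \<open>n a = 0\<close> both sides are zero.\<close>

lemma kravchuk_type_I_eq_limit_sum:
  assumes a: "a \<in> {1, 2}" and p: "0 < p 1" "p 1 < 1" "0 < p 2" "p 2 < 1" "p 1 \<noteq> p 2"
    and n: "n 1 + n 2 \<le> N + 1" and K: "kravchuk_type_I N p n K"
  shows "poly (K a) x = kravchuk_limit_sum N p n a 0 x"
proof (cases "n a = 0")
  case True
  moreover have "\<forall>c\<in>{1, 2}. K c = 0 \<or> degree (K c) + 1 \<le> n c"
    using K unfolding kravchuk_type_I_def by (rule conjunct1)
  then have "K a = 0 \<or> degree (K a) + 1 \<le> n a" using a by (rule bspec)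
  ultimately show ?thesis by (simp add: kravchuk_limit_sum_def)
next
  case False
  \<comment> \<open>The index other than \<open>a\<close>.\<close>
  define b where "b = 3 - a"
  have ab: "b \<in> {1, 2}" "hat p a = p b" "hat n a = n b" "n 1 + n 2 = n a + n b"
    "real N - real (n 1) - real (n 2) + 2 = real N - real (n a + n b) + 2"
    "p b \<noteq> p a" "0 < p a" "p a < 1" "0 < p b" "p b < 1"
    using a p by (auto simp: b_def hat_def)
  have form: "type_I_form N p K k = poly (K a) (real k) * kravchuk_weight N (p a) k
      + poly (K b) (real k) * kravchuk_weight N (p b) k" for k
    using a by (auto simp: type_I_form_def b_def)
  have "\<forall>c\<in>{1, 2}. K c = 0 \<or> degree (K c) + 1 \<le> n c"
    using K unfolding kravchuk_type_I_def by (rule conjunct1)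
  then have deg: "K a = 0 \<or> degree (K a) < n a" "K b = 0 \<or> degree (K b) < n b"
    using a ab(1) by (auto simp: Suc_le_eq)
  have "poly (K a) x = (\<Sum>t<n a. (- real (n b) gchoose (n a - 1 - t))
      / (pochhammer (- real N) (n a + n b - 1) * (p b - p a) ^ (n b + (n a - 1 - t)))
      * ((-1) ^ t * pochhammer (- real N) t / (fact t * (1 - p a) ^ t)) * poly (kravchuk_poly N (p a) t) x)"
  proof (rule type_I_expansion[where Kb = "K b"])
    fix j assume "j < n a + n b"
    then show "(\<Sum>k\<le>N. pochhammer (- real N + real k) j *
         (poly (K a) (real k) * kravchuk_weight N (p a) k + poly (K b) (real k) * kravchuk_weight N (p b) k))
      = (if j = n a + n b - 1 then 1 else 0)"
      using kravchuk_type_I_moments[OF K _ n, of j] p unfolding form ab(4) by simp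
  qed (use ab n False deg a in auto)
  also have "\<dots> = kravchuk_limit_sum N p n a 0 x"
    unfolding kravchuk_limit_sum_def ab
  proof (rule sum.cong[OF refl])
    fix t assume "t \<in> {..<n a}"
    define k where "k = n a - 1 - t"
    define W where "W = pochhammer (real N - real (n a + n b) + 2) (n b + k + t)"
    define \<delta> where "\<delta> = p b - p a"
    \<comment> \<open>All exponents become sums of \<open>n b\<close>, \<open>k\<close> and
      \<open>t\<close>, without truncated subtraction.\<close>
    have n1: "n a - 1 = k + t" "n a + n b - 1 = n b + k + t"
      using \<open>t \<in> _\<close> by (auto simp: k_def)
    have W: "pochhammer (- real N) (n b + k + t) = (-1) ^ (n b + k + t) * W"
    proof -
      have *: "real N - real (n b + k + t) + 1 = real N - real (n a + n b) + 2"
        unfolding n1(2)[symmetric] using False by (simp add: of_nat_diff)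
      show ?thesis unfolding W_def n1(2) pochhammer_minus * ..
    qed
    have d: "(p a - p b) ^ (n b + k + t) = (-1) ^ (n b + k + t) * (\<delta> ^ (n b + k) * \<delta> ^ t)"
      unfolding power_add[symmetric] power_mult_distrib[symmetric] by (simp add: \<delta>_def)
    have "\<delta> \<noteq> 0" using ab by (simp add: \<delta>_def)
    then have \<delta>: "\<delta> ^ t * (inverse (\<delta> ^ t) * z) = z" for z by simp
    show "(- real (n b) gchoose (n a - 1 - t))
      / (pochhammer (- real N) (n a + n b - 1) * (p b - p a) ^ (n b + (n a - 1 - t)))
      * ((-1) ^ t * pochhammer (- real N) t / (fact t * (1 - p a) ^ t)) * poly (kravchuk_poly N (p a) t) x
     = (-1) ^ (n a - 1) * pochhammer (real (n b) + 0) (n a - 1 - t) /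
      (fact (n a - 1 - t) * pochhammer (real N - real (n a + n b) + 2) (n a + n b - 1)
       * (p a - p b) ^ (n a + n b - 1))
     * ((p b - p a) ^ t / (1 - p a) ^ t * pochhammer (- real N) t / fact t * poly (kravchuk_poly N (p a) t) x)"
      unfolding k_def[symmetric] \<delta>_def[symmetric]
      unfolding n1
      unfolding W_def[symmetric] W d gbinomial_uminus_pochhammer
      by (simp add: power_add divide_inverse mult_ac \<delta>)
  qed
  finally show ?thesis .
qed

lemma kravchuk_kappa_eps_0:
  assumes a: "a \<in> {1, 2}" and n: "1 \<le> n 1" "1 \<le> n 2"
  shows "kravchuk_kappa_eps N p n a 0 = kravchuk_kappa N p n a"
proof -
  have rG: "rGamma (real m) = 1 / fact (m - 1)" if "1 \<le> m" for m
    using that Gamma_fact[of "m - 1", where 'a = real]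
    by (cases m) (simp_all add: rGamma_inverse_Gamma divide_inverse)
  have "real (n 1) + real (n 2) - 1 + 0 = 1 + real (n 1 + n 2 - 2)"
    using n by linarith
  then have "Gamma (real (n 1) + real (n 2) - 1 + 0) = fact (n 1 + n 2 - 2)"
    by (simp only: Gamma_fact)
  then show ?thesis using a n
    by (auto simp: kravchuk_kappa_eps_def kravchuk_kappa_def hat_def rG divide_inverse mult_ac)
qed

theorem proposition6p1:
  fixes N :: nat and p :: "nat \<Rightarrow> real" and n :: "nat \<Rightarrow> nat" and K :: "nat \<Rightarrow> real poly"
  assumes "0 < p 1" and "p 1 < 1" and "0 < p 2" and "p 2 < 1" and "p 1 \<noteq> p 2"
    and "n 1 + n 2 \<le> N + 1"
    and "kravchuk_type_I N p n K"
  shows "\<forall>a\<in>{1, 2}. \<forall>x :: real.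
      (n 1 \<ge> 1 \<and> n 2 \<ge> 1 \<longrightarrow>
         poly (K a) x = kravchuk_kappa N p n a
           * kravchuk_series N p n a (- real (n 1) - real (n 2) + 2) x \<and>
         poly (K a) x = kravchuk_kappa N p n a
           * kravchuk_double_sum N p n a (- real (n 1) - real (n 2) + 2) x) \<and>
      (n 1 = 0 \<or> n 2 = 0 \<longrightarrow>
         ((\<lambda>\<epsilon>. kravchuk_kappa_eps N p n a \<epsilon>
           * kravchuk_series N p n a (- real (n 1) - real (n 2) + 2 - \<epsilon>) x)
             \<longlongrightarrow> poly (K a) x) (at 0) \<and>
         ((\<lambda>\<epsilon>. kravchuk_kappa_eps N p n a \<epsilon>
           * kravchuk_double_sum N p n a (- real (n 1) - real (n 2) + 2 - \<epsilon>) x)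
             \<longlongrightarrow> poly (K a) x) (at 0))"
proof (intro ballI allI)
  fix a :: nat and x :: real
  assume a: "a \<in> {1, 2}"
  let ?c = "- real (n 1) - real (n 2) + 2"
  have pa: "0 < p a" "p a < 1" using a assms by auto
  have K: "poly (K a) x = kravchuk_limit_sum N p n a 0 x"
    by (rule kravchuk_type_I_eq_limit_sum[OF a assms])
  \<comment> \<open>For \<open>n a = 0\<close> series and double sum may differ, but
    \<open>rGamma 0 = 0\<close> makes the prefactor vanish.\<close>
  have series: "kravchuk_kappa_eps N p n a \<epsilon> * kravchuk_series N p n a c x
      = kravchuk_kappa_eps N p n a \<epsilon> * kravchuk_double_sum N p n a c x" for \<epsilon> c
    by (cases "n a = 0") (simp_all add: kravchuk_kappa_eps_def kravchuk_series_eq_double_sum)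
  have regular: "poly (K a) x = kravchuk_kappa N p n a * kravchuk_double_sum N p n a ?c x"
    if n: "1 \<le> n 1" "1 \<le> n 2"
  proof -
    \<comment> \<open>With both indices positive, \<open>\<epsilon> = 0\<close> is itself admissible
      and no limit is taken.\<close>
    have "real (hat n a) + 0 \<notin> \<int>\<^sub>\<le>\<^sub>0" using n by (simp add: hat_def of_nat_in_nonpos_Ints_iff)
    from kravchuk_kappa_eps_double_sum[where p = p, OF a pa this, of N x] show ?thesis
      by (simp add: K kravchuk_kappa_eps_0[OF a n])
  qed
  have "\<forall>\<^sub>F \<epsilon> in at 0. kravchuk_limit_sum N p n a \<epsilon> x
      = kravchuk_kappa_eps N p n a \<epsilon> * kravchuk_double_sum N p n a (?c - \<epsilon>) x"
    unfolding eventually_at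
  proof (intro exI[of _ "1::real"] conjI ballI impI)
    fix \<epsilon> :: real assume \<epsilon>: "\<epsilon> \<noteq> 0 \<and> dist \<epsilon> 0 < 1"
    \<comment> \<open>A nonpositive integer value would make \<open>\<epsilon>\<close> an integer of
      absolute value below 1, hence zero.\<close>
    have "real (hat n a) + \<epsilon> \<notin> \<int>\<^sub>\<le>\<^sub>0"
    proof
      assume "real (hat n a) + \<epsilon> \<in> \<int>\<^sub>\<le>\<^sub>0"
      then obtain m where "real (hat n a) + \<epsilon> = - real m" by (elim nonpos_Ints_cases')
      then have m: "\<epsilon> = - real (m + hat n a)" by simp
      with \<epsilon> have "real (m + hat n a) < 1" by (simp add: dist_real_def)
      then have "m + hat n a = 0" by linarith
      with m \<epsilon> show False by simp
    qed
    then show "kravchuk_limit_sum N p n a \<epsilon> x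
      = kravchuk_kappa_eps N p n a \<epsilon> * kravchuk_double_sum N p n a (?c - \<epsilon>) x"
      by (rule kravchuk_kappa_eps_double_sum[where p = p, OF a pa, symmetric])
  qed simp
  then have limit: "((\<lambda>\<epsilon>. kravchuk_kappa_eps N p n a \<epsilon> * kravchuk_double_sum N p n a (?c - \<epsilon>) x)
      \<longlongrightarrow> poly (K a) x) (at 0)"
    unfolding K by (rule Lim_transform_eventually[OF tendsto_kravchuk_limit_sum])
  have na: "1 \<le> n a" if "1 \<le> n 1" "1 \<le> n 2" using a that by auto
  show "(n 1 \<ge> 1 \<and> n 2 \<ge> 1 \<longrightarrow>
         poly (K a) x = kravchuk_kappa N p n a * kravchuk_series N p n a ?c x \<and>
         poly (K a) x = kravchuk_kappa N p n a * kravchuk_double_sum N p n a ?c x) \<and>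
      (n 1 = 0 \<or> n 2 = 0 \<longrightarrow>
         ((\<lambda>\<epsilon>. kravchuk_kappa_eps N p n a \<epsilon> * kravchuk_series N p n a (?c - \<epsilon>) x)
             \<longlongrightarrow> poly (K a) x) (at 0) \<and>
         ((\<lambda>\<epsilon>. kravchuk_kappa_eps N p n a \<epsilon> * kravchuk_double_sum N p n a (?c - \<epsilon>) x)
             \<longlongrightarrow> poly (K a) x) (at 0))"
    unfolding series using limit regular kravchuk_series_eq_double_sum[of n a N p ?c x, OF na]
    by (auto simp del: One_nat_def)
qed

end
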